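(* Let $\mathcal{Q}=\{A_1,A_2\}$. Then for every integer $n\ge 1$, $$s_n(\mathcal{Q}\cup\{B_1\})=s_n(\mathcal{Q}\cup\{B_2\})=s_n(\mathcal{Q}\cup\{B_3\})=\tfrac32(2n)!!,$$ $$s_n(\mathcal{Q}\cup\{B_4\})=s_n(\mathcal{Q}\cup\{B_5\})=(2n+2)(2n-1)!!-\tfrac12(2n)!!,$$ $$s_n(\mathcal{Q}\cup\{B_6\})=(2n^2+8n+1)(2n-2)!!-(4n+4)(2n-1)!!.$$
   Context: A standard piece is a $2\times 2$ matrix whose four entries are $1,2,3,4$, each occurring exactly once. For $n\ge 1$, a standard $n$-puzzle is a $2\times(n+1)$ matrix whose entries are $1,2,\dots,2n+2$, each occurring exactly once; its pieces are its $n$ submatrices formed by two consecutive columns. The reduction of a piece is the standard piece obtained by replacing its four distinct entries by $1,2,3,4$ in an order-preserving way. A set $\mathcal{P}$ of standard pieces is a support of a puzzle if the reduction of each piece of the puzzle lies in $\mathcal{P}$. $S_n(\mathcal{P})$ is the set of standard $n$-puzzles having $\mathcal{P}$ as a support, and $s_n(\mathcal{P})=|S_n(\mathcal{P})|$. The standard pieces used are $A_1=\left[\begin{smallmatrix}4&3\\1&2\end{smallmatrix}\right]$, $A_2=\left[\begin{smallmatrix}3&4\\1&2\end{smallmatrix}\right]$, and $B_1=\left[\begin{smallmatrix}4&2\\1&3\end{smallmatrix}\right]$, $B_2=\left[\begin{smallmatrix}3&2\\1&4\end{smallmatrix}\right]$, $B_3=\left[\begin{smallmatrix}2&3\\1&4\end{smallmatrix}\right]$,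 $B_4=\left[\begin{smallmatrix}3&1\\2&4\end{smallmatrix}\right]$, $B_5=\left[\begin{smallmatrix}4&1\\2&3\end{smallmatrix}\right]$, $B_6=\left[\begin{smallmatrix}4&1\\3&2\end{smallmatrix}\right]$. Double factorials: $(2n-1)!!=(2n-1)(2n-3)\cdots 3\cdot 1$ and $(2n)!!=(2n)(2n-2)\cdots 2$, with $0!!=1$. *)

theory Defs
  imports Complex_Main "Jordan_Normal_Form.Matrix" "Jordan_Normal_Form.DL_Submatrix"
begin

definition standard_puzzles :: "nat \<Rightarrow> nat mat set" where
  "standard_puzzles n =
     {M \<in> carrier_mat 2 (n + 1).
        bij_betw (\<lambda>ij. M $$ ij) ({0..<2} \<times> {0..<n + 1}) {1..2 * n + 2}}"

definition standard_pieces :: "nat mat set" where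
  "standard_pieces =
     {P \<in> carrier_mat 2 2. bij_betw (\<lambda>ij. P $$ ij) ({0..<2} \<times> {0..<2}) {1..4}}"

definition pieces :: "nat mat \<Rightarrow> nat mat set" where
  "pieces M = {submatrix M UNIV {j, j + 1} | j. j + 1 < dim_col M}"

(* Every entry is replaced by its rank among the entries; for pairwise distinct entries this
   is the order-preserving relabelling by 1, 2, 3, ... (see reduction_standard_piece and
   reduction_less_iff below). *)
definition reduction :: "nat mat \<Rightarrow> nat mat" where
  "reduction P = map_mat (\<lambda>x. card {y \<in> elements_mat P. y \<le> x}) P"

definition is_support :: "nat mat set \<Rightarrow> nat mat \<Rightarrow> bool" where
  "is_support \<P> M \<longleftrightarrow> (\<forall>P \<in> pieces M. reduction P \<in> \<P>)"

definition S_puzzles :: "nat \<Rightarrow> nat mat set \<Rightarrow> nat mat set" where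
  "S_puzzles n \<P> = {M \<in> standard_puzzles n. is_support \<P> M}"

definition s_count :: "nat \<Rightarrow> nat mat set \<Rightarrow> nat" where
  "s_count n \<P> = card (S_puzzles n \<P>)"

(* Rows are listed from top to bottom, as displayed in print. *)
definition A1 :: "nat mat" where "A1 = mat_of_rows_list 2 [[4, 3], [1, 2]]"
definition A2 :: "nat mat" where "A2 = mat_of_rows_list 2 [[3, 4], [1, 2]]"
definition B1 :: "nat mat" where "B1 = mat_of_rows_list 2 [[4, 2], [1, 3]]"
definition B2 :: "nat mat" where "B2 = mat_of_rows_list 2 [[3, 2], [1, 4]]"
definition B3 :: "nat mat" where "B3 = mat_of_rows_list 2 [[2, 3], [1, 4]]"
definition B4 :: "nat mat" where "B4 = mat_of_rows_list 2 [[3, 1], [2, 4]]"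
definition B5 :: "nat mat" where "B5 = mat_of_rows_list 2 [[4, 1], [2, 3]]"
definition B6 :: "nat mat" where "B6 = mat_of_rows_list 2 [[4, 1], [3, 2]]"

definition Q_pieces :: "nat mat set" where
  "Q_pieces = {A1, A2}"

fun double_fact :: "nat \<Rightarrow> nat" where
  "double_fact 0 = 1"
| "double_fact (Suc 0) = 1"
| "double_fact (Suc (Suc n)) = Suc (Suc n) * double_fact n"

lemma standard_pieces_eq: "standard_pieces = standard_puzzles 1"
proof -
  have "(1 :: nat) + 1 = 2" "2 * 1 + 2 = (4 :: nat)" by simp_all
  then show ?thesis unfolding standard_pieces_def standard_puzzles_def by presburger
qed

lemma square_index_set: "{0..<2 :: nat} \<times> {0..<2 :: nat} = {(0, 0), (0, 1), (1, 0), (1, 1)}"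
  by (auto simp: numeral_2_eq_2 less_Suc_eq)

lemma named_pieces_standard: "{A1, A2, B1, B2, B3, B4, B5, B6} \<subseteq> standard_pieces"
proof -
  have "{1..4} = {1, 2, 3, 4 :: nat}" by auto
  then show ?thesis
    by (auto simp: standard_pieces_def square_index_set bij_betw_def mat_of_rows_list_def
        A1_def A2_def B1_def B2_def B3_def B4_def B5_def B6_def)
qed

lemma rank_strict_mono:
  fixes E :: "nat set"
  assumes "finite E" "y \<in> E" "x < y"
  shows "card {z \<in> E. z \<le> x} < card {z \<in> E. z \<le> y}"
proof (rule psubset_card_mono)
  have "y \<in> {z \<in> E. z \<le> y}" "y \<notin> {z \<in> E. z \<le> x}" using assms by auto
  then show "{z \<in> E. z \<le> x} \<subset> {z \<in> E. z \<le> y}" using assms(3) by fastforce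
qed (use assms in auto)

lemma finite_elements_mat: "finite (elements_mat M)"
  by (simp add: elements_mat_def)

lemma reduction_less_iff:
  assumes "P \<in> carrier_mat nr nc" "i < nr" "j < nc" "k < nr" "l < nc"
  shows "reduction P $$ (i, j) < reduction P $$ (k, l) \<longleftrightarrow> P $$ (i, j) < P $$ (k, l)"
proof -
  have el: "P $$ (i, j) \<in> elements_mat P" "P $$ (k, l) \<in> elements_mat P"
    using assms by (auto intro: elements_matI)
  have red: "reduction P $$ (a, b) = card {z \<in> elements_mat P. z \<le> P $$ (a, b)}"
    if "a < nr" "b < nc" for a b
    using that assms(1) by (auto simp: reduction_def)
  show ?thesis
    using rank_strict_mono[OF finite_elements_mat el(1), of "P $$ (k, l)"]
      rank_strict_mono[OF finite_elements_mat el(2), of "P $$ (i, j)"] assms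
    by (cases "P $$ (i, j)" "P $$ (k, l)" rule: linorder_cases) (auto simp: red)
qed

lemma reduction_standard_piece:
  assumes P: "P \<in> carrier_mat 2 2" and inj: "inj_on (\<lambda>ij. P $$ ij) ({0..<2} \<times> {0..<2})"
  shows "reduction P \<in> standard_pieces"
proof -
  let ?I = "{0..<2} \<times> {0..<2 :: nat} :: (nat \<times> nat) set"
  let ?f = "\<lambda>ij. reduction P $$ ij"
  have elems: "elements_mat P = (\<lambda>ij. P $$ ij) ` ?I"
    using P by (fastforce simp: elements_mat_def)
  have card_el: "card (elements_mat P) = 4"
    unfolding elems by (subst card_image[OF inj]) simp
  have red: "?f ij = card {z \<in> elements_mat P. z \<le> P $$ ij}" if "ij \<in> ?I" for ij
    using that P by (auto simp: reduction_def)
  have inj_f: "inj_on ?f ?I"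
  proof (rule inj_onI)
    fix u v assume u: "u \<in> ?I" and v: "v \<in> ?I" and eq: "?f u = ?f v"
    then have "P $$ u = P $$ v"
      using reduction_less_iff[OF P, of "fst u" "snd u" "fst v" "snd v"]
        reduction_less_iff[OF P, of "fst v" "snd v" "fst u" "snd u"]
      by (metis SigmaE atLeastLessThan_iff fst_conv less_irrefl nat_neq_iff snd_conv)
    then show "u = v" using inj u v by (auto dest: inj_onD)
  qed
  have sub: "?f ` ?I \<subseteq> {1..4}"
  proof
    fix y assume "y \<in> ?f ` ?I"
    then obtain u where u: "u \<in> ?I" and y: "y = ?f u" by blast
    have "P $$ u \<in> {z \<in> elements_mat P. z \<le> P $$ u}" using u elems by auto
    then have "card {z \<in> elements_mat P. z \<le> P $$ u} > 0"
      using finite_elements_mat[of P] by (auto simp: card_gt_0_iff)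
    moreover have "card {z \<in> elements_mat P. z \<le> P $$ u} \<le> 4"
      unfolding card_el[symmetric] by (rule card_mono) (auto simp: finite_elements_mat)
    ultimately show "y \<in> {1..4}" using red[OF u] y by simp
  qed
  have "?f ` ?I = {1..4}"
    by (rule card_subset_eq[OF _ sub]) (simp_all add: card_image[OF inj_f])
  moreover have "reduction P \<in> carrier_mat 2 2"
    using P by (simp add: reduction_def)
  ultimately show ?thesis
    using inj_f by (simp add: standard_pieces_def bij_betw_def)
qed

lemma pick_pair: "pick {j, j + 1} 0 = j" "pick {j, j + 1} (Suc 0) = j + 1"
proof -
  show *: "pick {j, j + 1} 0 = j" by (auto intro!: Least_equality)
  have "pick {j, j + 1} (Suc 0) = (LEAST a. a \<in> {j, j + 1} \<and> pick {j, j + 1} 0 < a)"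
    by simp
  then show "pick {j, j + 1} (Suc 0) = j + 1"
    unfolding * by (auto intro!: Least_equality)
qed

lemma piece_eq:
  assumes M: "M \<in> carrier_mat 2 m" and j: "j + 1 < m"
  shows "submatrix M UNIV {j, j + 1} = mat 2 2 (\<lambda>(i, k). M $$ (i, j + k))"
proof -
  have cols: "{k. k < dim_col M \<and> k \<in> {j, j + 1}} = {j, j + 1}" using M j by auto
  have rows: "{i. i < dim_row M \<and> i \<in> UNIV} = {0, 1}" using M by auto
  have cards: "card {j, j + 1} = 2" "card {0, 1 :: nat} = 2" by simp_all
  show ?thesis
    unfolding submatrix_def cols rows cards
    by (rule eq_matI) (auto simp: pick_UNIV less_2_cases_iff pick_pair[unfolded Suc_eq_plus1[symmetric]] simp del: pick.simps)
qed

end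

(* Each of A1, A2, B1, ..., B6 has its left column increasing upwards, while each B_i has its
   right column decreasing upwards; so a B_i can only be the last piece of a puzzle, and the
   count is that of the puzzles over {A1, A2} plus that of the puzzles ending in B_i.

   In either case, with l_j and u_j the lower and upper entries of column j = 0, ..., p + 1
   (n = p + 1), the pieces before the last one say l_0 < ... < l_p and l_(j+1) < u_j for j < p
   (l_p < u_p is then forced by the last piece).  If e further entries lie above l_p, subject
   to constraints among themselves with c solutions, the constraints form a tree and there are
   c (e + 1) (e + 3) ... (e + 2p - 1) puzzles.  For A1, A2, B1, B2, B3 this is the answer.  For
   B4, B5 and B6 some entries lie below l_p, and complementing that condition yields trees
   together with unconstrained entries. *)

theory Submission
  imports Defs
begin

section \<open>Counting bijections under order constraints\<close>

definition bijections :: "'a set \<Rightarrow> nat set \<Rightarrow> ('a \<Rightarrow> nat) set" where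
  "bijections I V = {f \<in> extensional I. bij_betw f I V}"

text \<open>Quantifying over all value sets \<open>V\<close> makes it possible to remove the value of one node
  and count the rest on the remaining values, without renumbering them.\<close>
definition has_count :: "'a set \<Rightarrow> (('a \<Rightarrow> nat) \<Rightarrow> bool) \<Rightarrow> real \<Rightarrow> bool" where
  "has_count I P c \<longleftrightarrow>
     (\<forall>V. finite V \<longrightarrow> card V = card I \<longrightarrow> real (card {f \<in> bijections I V. P f}) = c)"

lemma finite_bijections:
  assumes "finite I" "finite V"
  shows "finite (bijections I V)"
proof (rule finite_subset)
  show "bijections I V \<subseteq> I \<rightarrow>\<^sub>E V"
    by (auto simp: bijections_def PiE_def bij_betw_def)
qed (use assms in \<open>auto intro: finite_PiE\<close>)

lemma bijectionsD:
  assumes "f \<in> bijections I V"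
  shows "inj_on f I" "f ` I = V" "f \<in> extensional I"
  using assms by (auto simp: bijections_def bij_betw_def)

section \<open>Adding one node to a constraint system\<close>

lemma bijections_insert:
  assumes "t \<notin> I"
  shows "f \<in> bijections (insert t I) V \<longleftrightarrow>
    f t \<in> V \<and> (\<exists>g \<in> bijections I (V - {f t}). f = g(t := f t))"
proof
  assume f: "f \<in> bijections (insert t I) V"
  \<comment> \<open>Resetting \<open>t\<close> to \<open>undefined\<close> keeps the restriction
    extensional on \<open>I\<close>, so that it is a member of
    \<open>bijections I (V - {f t})\<close>.\<close>
  let ?g = "f(t := undefined)"
  have "inj_on ?g I" "?g ` I = f ` I"
    using bijectionsD(1)[OF f] assms by (auto simp: inj_on_def)
  moreover have "f ` I = V - {f t}"
    using bijectionsD(1,2)[OF f] assms by (auto simp: inj_on_def)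
  moreover have "?g \<in> extensional I"
    using bijectionsD(3)[OF f] by (auto simp: extensional_def)
  ultimately have "?g \<in> bijections I (V - {f t})"
    by (simp add: bijections_def bij_betw_def)
  moreover have "f = ?g(t := f t)" by auto
  moreover have "f t \<in> V" using bijectionsD(2)[OF f] by auto
  ultimately show "f t \<in> V \<and> (\<exists>g \<in> bijections I (V - {f t}). f = g(t := f t))" by blast
next
  assume "f t \<in> V \<and> (\<exists>g \<in> bijections I (V - {f t}). f = g(t := f t))"
  then obtain g v where v: "v \<in> V" and g: "g \<in> bijections I (V - {v})" and f: "f = g(t := v)"
    by blast
  have "inj_on f I" "f ` I = g ` I"
    using bijectionsD(1)[OF g] assms by (auto simp: f inj_on_def)
  then have "inj_on f (insert t I)" "f ` insert t I = V"
    using bijectionsD(2)[OF g] assms v by (auto simp: f)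
  moreover have "f \<in> extensional (insert t I)"
    using bijectionsD(3)[OF g] by (auto simp: f extensional_def)
  ultimately show "f \<in> bijections (insert t I) V"
    by (simp add: bijections_def bij_betw_def)
qed

text \<open>Source of all the rules that add a node. Once a value \<open>v\<close> in
  \<open>W\<close> is chosen for \<open>t\<close>, the rest is a filling of \<open>I\<close> by
  \<open>V - {v}\<close>, and there are \<open>c\<close> of these whatever \<open>v\<close> is,
  because \<open>has_count\<close> speaks of every value set of the right size.\<close>

lemma card_bijections_insert:
  assumes "has_count I P c" "finite I" "t \<notin> I" "finite V" "card V = Suc (card I)" "W \<subseteq> V"
    and P: "\<And>f v. P (f(t := v)) = P f"
  shows "real (card {f \<in> bijections (insert t I) V. P f \<and> f t \<in> W}) = real (card W) * c"
proof -
  let ?F = "\<lambda>v. {g \<in> bijections I (V - {v}). P g}"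
  have W: "finite W" using assms(4,6) finite_subset by blast
  have fin: "finite (?F v)" for v
    using finite_bijections[of I "V - {v}"] assms(2,4) by simp
  have eq: "{f \<in> bijections (insert t I) V. P f \<and> f t \<in> W} = (\<Union>v\<in>W. (\<lambda>g. g(t := v)) ` ?F v)"
  proof (intro equalityI subsetI)
    fix f assume "f \<in> {f \<in> bijections (insert t I) V. P f \<and> f t \<in> W}"
    then have f: "P f" "f t \<in> W" and "f \<in> bijections (insert t I) V" by auto
    then obtain g where g: "g \<in> bijections I (V - {f t})" "f = g(t := f t)"
      using bijections_insert[OF assms(3)] by blast
    then have "P g" using f(1) P by metis
    then show "f \<in> (\<Union>v\<in>W. (\<lambda>g. g(t := v)) ` ?F v)"
      using f(2) g by blast
  next
    fix f assume "f \<in> (\<Union>v\<in>W. (\<lambda>g. g(t := v)) ` ?F v)"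
    then obtain v g where "v \<in> W" "g \<in> ?F v" "f = g(t := v)" by blast
    then show "f \<in> {f \<in> bijections (insert t I) V. P f \<and> f t \<in> W}"
      using assms(6) P bijections_insert[OF assms(3), of f V] by auto
  qed
  have card: "real (card ((\<lambda>g. g(t := v)) ` ?F v)) = c" if "v \<in> W" for v
  proof -
    have "inj_on (\<lambda>g. g(t := v)) (?F v)"
    proof (rule inj_onI)
      fix g h assume gh: "g \<in> ?F v" "h \<in> ?F v" "g(t := v) = h(t := v)"
      have "g t = h t"
        using gh(1,2) assms(3) by (auto simp: bijections_def extensional_def)
      then show "g = h" using gh(3) by (metis fun_upd_triv fun_upd_upd)
    qed
    then have "card ((\<lambda>g. g(t := v)) ` ?F v) = card (?F v)" by (rule card_image)
    moreover have "card (V - {v}) = card I" using that assms(4,5,6) by auto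
    ultimately show ?thesis
      using assms(1,4) by (simp add: has_count_def)
  qed
  have "card (\<Union>v\<in>W. (\<lambda>g. g(t := v)) ` ?F v) = (\<Sum>v\<in>W. card ((\<lambda>g. g(t := v)) ` ?F v))"
  proof (rule card_UN_disjoint)
    show "\<forall>i\<in>W. \<forall>j\<in>W. i \<noteq> j \<longrightarrow> (\<lambda>g. g(t := i)) ` ?F i \<inter> (\<lambda>g. g(t := j)) ` ?F j = {}"
      by (auto dest: fun_cong[of _ _ t])
  qed (use W fin in auto)
  then show ?thesis unfolding eq using card by simp
qed

text \<open>Only injective fillings are counted, so the two conditions may differ on fillings with
  ties. This is what lets a negated strict inequality be read as the reversed strict one.\<close>

lemma has_count_cong:
  assumes "has_count I P c" "\<And>f. inj_on f I \<Longrightarrow> Q f \<longleftrightarrow> P f"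
  shows "has_count I Q c"
proof -
  have "{f \<in> bijections I V. Q f} = {f \<in> bijections I V. P f}" for V
    using assms(2) bijectionsD(1) by blast
  then show ?thesis using assms(1) by (simp add: has_count_def)
qed

lemma has_count_singleton: "has_count {a} (\<lambda>_. True) 1"
  unfolding has_count_def
proof (intro allI impI)
  fix V :: "nat set" assume "card V = card {a}"
  then obtain v where "V = {v}" by (auto simp: card_1_singleton_iff)
  then have "{f \<in> bijections {a} V. True} = {\<lambda>x. if x = a then v else undefined}"
    by (auto simp: bijections_def bij_betw_def extensional_def)
  then show "real (card {f \<in> bijections {a} V. True}) = 1" by simp
qed

lemma has_count_free:
  assumes "has_count I P c" "finite I" "t \<notin> I" "\<And>f v. P (f(t := v)) = P f"
  shows "has_count (insert t I) P ((real (card I) + 1) * c)"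
  unfolding has_count_def
proof (intro allI impI)
  fix V :: "nat set" assume V: "finite V" "card V = card (insert t I)"
  have "{f \<in> bijections (insert t I) V. P f} = {f \<in> bijections (insert t I) V. P f \<and> f t \<in> V}"
    by (auto dest: bijectionsD(2))
  then show "real (card {f \<in> bijections (insert t I) V. P f}) = (real (card I) + 1) * c"
    using card_bijections_insert[OF assms(1-3) V(1) _ order_refl assms(4)] V assms(2,3) by simp
qed

lemma bijection_min_iff:
  assumes "f \<in> bijections J V" "finite J" "r \<in> J"
  shows "f r = Min V \<longleftrightarrow> (\<forall>x\<in>J. f r \<le> f x)"
proof -
  have "V = f ` J" using bijectionsD(2)[OF assms(1)] by simp
  then show ?thesis
    using assms(2,3) by (auto intro!: Min_eqI[symmetric])
qed

text \<open>A node below all others must receive the least value, which is a single choice: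
  \<open>W = {Min V}\<close>.\<close>

lemma has_count_min:
  assumes "has_count I P c" "finite I" "r \<notin> I" "\<And>f v. P (f(r := v)) = P f"
  shows "has_count (insert r I) (\<lambda>f. P f \<and> (\<forall>x\<in>I. f r < f x)) c"
  unfolding has_count_def
proof (intro allI impI)
  fix V :: "nat set" assume V: "finite V" "card V = card (insert r I)"
  then have cV: "card V = Suc (card I)" using assms(2,3) by simp
  then have "Min V \<in> V" using V(1) by (metis Min_in card.empty nat.distinct(1))
  have "(\<forall>x\<in>I. f r < f x) \<longleftrightarrow> f r \<in> {Min V}" if f: "f \<in> bijections (insert r I) V" for f
  proof -
    have "f x \<noteq> f r" if "x \<in> I" for x
      using bijectionsD(1)[OF f] assms(3) that by (auto simp: inj_on_def)
    then have "(\<forall>x\<in>I. f r < f x) \<longleftrightarrow> (\<forall>x\<in>insert r I. f r \<le> f x)"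
      by (metis insert_iff le_less order_refl)
    then show ?thesis
      using bijection_min_iff[OF f, of r] assms(2) by simp
  qed
  then have "{f \<in> bijections (insert r I) V. P f \<and> (\<forall>x\<in>I. f r < f x)} =
      {f \<in> bijections (insert r I) V. P f \<and> f r \<in> {Min V}}" by blast
  then show "real (card {f \<in> bijections (insert r I) V. P f \<and> (\<forall>x\<in>I. f r < f x)}) = c"
    using card_bijections_insert[OF assms(1-3) V(1) cV _ assms(4), of "{Min V}"] \<open>Min V \<in> V\<close>
    by simp
qed

text \<open>Since \<open>r\<close> carries the least value on \<open>I\<close>, the minimum of
  \<open>V\<close> is taken at \<open>r\<close> or at \<open>t\<close>. Being above \<open>r\<close>
  thus excludes exactly one value for \<open>t\<close>: \<open>W = V - {Min V}\<close>, which has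
  \<open>card I\<close> elements.\<close>

lemma has_count_above_min:
  assumes "has_count I P c" "finite I" "t \<notin> I" "\<And>f v. P (f(t := v)) = P f"
    and r: "r \<in> I" "\<And>f x. P f \<Longrightarrow> x \<in> I \<Longrightarrow> f r \<le> f x"
  shows "has_count (insert t I) (\<lambda>f. P f \<and> f r < f t) (real (card I) * c)"
  unfolding has_count_def
proof (intro allI impI)
  fix V :: "nat set" assume V: "finite V" "card V = card (insert t I)"
  then have cV: "card V = Suc (card I)" using assms(2,3) by simp
  then have "Min V \<in> V" using V(1) by (metis Min_in card.empty nat.distinct(1))
  have "f r < f t \<longleftrightarrow> f t \<in> V - {Min V}" if f: "f \<in> bijections (insert t I) V" and "P f" for f
  proof -
    have "f t \<noteq> f r"
      using bijectionsD(1)[OF f] assms(3) r(1) by (auto simp: inj_on_def)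
    moreover have "f t \<in> V" using bijectionsD(2)[OF f] by auto
    moreover have "f r < f t \<longleftrightarrow> f t \<noteq> Min V"
    proof -
      have "f r < f t \<longleftrightarrow> \<not> (\<forall>x\<in>insert t I. f t \<le> f x)"
        using \<open>f t \<noteq> f r\<close> r(1) r(2)[OF \<open>P f\<close>]
        by (metis insert_iff le_less not_le order.trans order_refl)
      then show ?thesis using bijection_min_iff[OF f, of t] assms(2) by simp
    qed
    ultimately show ?thesis by simp
  qed
  then have "{f \<in> bijections (insert t I) V. P f \<and> f r < f t} =
      {f \<in> bijections (insert t I) V. P f \<and> f t \<in> V - {Min V}}" by blast
  then show "real (card {f \<in> bijections (insert t I) V. P f \<and> f r < f t}) = real (card I) * c"
    using card_bijections_insert[OF assms(1-3) V(1) cV _ assms(4), of "V - {Min V}"]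
      \<open>Min V \<in> V\<close> V(1) cV by simp
qed

section \<open>Complementary conditions and symmetry\<close>

lemma has_count_split:
  assumes "finite I" "has_count I (\<lambda>f. P f \<and> Q f) c" "has_count I (\<lambda>f. P f \<and> \<not> Q f) d"
  shows "has_count I P (c + d)"
  unfolding has_count_def
proof (intro allI impI)
  fix V :: "nat set" assume V: "finite V" "card V = card I"
  let ?B = "bijections I V"
  have "{f \<in> ?B. P f} = {f \<in> ?B. P f \<and> Q f} \<union> {f \<in> ?B. P f \<and> \<not> Q f}" by blast
  moreover have "card ({f \<in> ?B. P f \<and> Q f} \<union> {f \<in> ?B. P f \<and> \<not> Q f}) =
      card {f \<in> ?B. P f \<and> Q f} + card {f \<in> ?B. P f \<and> \<not> Q f}"
    using finite_bijections[OF assms(1) V(1)] by (intro card_Un_disjoint) auto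
  ultimately show "real (card {f \<in> ?B. P f}) = c + d"
    using assms(2,3) V by (simp add: has_count_def)
qed

lemma has_count_diff:
  assumes "finite I" "has_count I P c" "has_count I (\<lambda>f. P f \<and> Q f) d"
  shows "has_count I (\<lambda>f. P f \<and> \<not> Q f) (c - d)"
  unfolding has_count_def
proof (intro allI impI)
  fix V :: "nat set" assume V: "finite V" "card V = card I"
  let ?B = "bijections I V"
  have "{f \<in> ?B. P f \<and> \<not> Q f} = {f \<in> ?B. P f} - {f \<in> ?B. P f \<and> Q f}" by blast
  moreover have "card ({f \<in> ?B. P f} - {f \<in> ?B. P f \<and> Q f}) =
      card {f \<in> ?B. P f} - card {f \<in> ?B. P f \<and> Q f}"
    using finite_bijections[OF assms(1) V(1)] by (intro card_Diff_subset) auto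
  moreover have "card {f \<in> ?B. P f \<and> Q f} \<le> card {f \<in> ?B. P f}"
    using finite_bijections[OF assms(1) V(1)] by (intro card_mono) auto
  ultimately show "real (card {f \<in> ?B. P f \<and> \<not> Q f}) = c - d"
    using assms(2,3) V by (simp add: has_count_def of_nat_diff)
qed

text \<open>Composition with the transposition of \<open>a\<close> and \<open>b\<close> is an
  involution that preserves \<open>P\<close> and exchanges \<open>f a < f b\<close> with
  \<open>f b < f a\<close>; by injectivity exactly one of these holds.\<close>

lemma has_count_symmetric:
  assumes "finite I" "has_count I P c" "a \<in> I" "b \<in> I" "a \<noteq> b"
    and P: "\<And>f. P (f \<circ> Transposition.transpose a b) = P f"
  shows "has_count I (\<lambda>f. P f \<and> f a < f b) (c / 2)"
  unfolding has_count_def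
proof (intro allI impI)
  fix V :: "nat set" assume V: "finite V" "card V = card I"
  let ?B = "bijections I V" and ?\<tau> = "Transposition.transpose a b"
  have perm: "bij_betw ?\<tau> I I"
    using assms(3,4) by (intro bij_betw_byWitness[where f' = ?\<tau>])
      (auto simp: Transposition.transpose_def)
  have swap: "f \<circ> ?\<tau> \<in> ?B" if "f \<in> ?B" for f
  proof -
    have "f \<circ> ?\<tau> \<in> extensional I"
      using that assms(3,4) by (auto simp: bijections_def extensional_def Transposition.transpose_def)
    then show ?thesis
      using that bij_betw_trans[OF perm] by (auto simp: bijections_def)
  qed
  have inv: "(f \<circ> ?\<tau>) \<circ> ?\<tau> = f" for f :: "'a \<Rightarrow> nat" by (auto simp: fun_eq_iff)
  have "bij_betw (\<lambda>f. f \<circ> ?\<tau>) {f \<in> ?B. P f \<and> f a < f b} {f \<in> ?B. P f \<and> f b < f a}"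
    using swap P inv by (intro bij_betw_byWitness[where f' = "\<lambda>f. f \<circ> ?\<tau>"]) auto
  then have eq: "card {f \<in> ?B. P f \<and> f a < f b} = card {f \<in> ?B. P f \<and> f b < f a}"
    by (rule bij_betw_same_card)
  have "f a \<noteq> f b" if "f \<in> ?B" for f
    using bijectionsD(1)[OF that] assms(3-5) by (auto simp: inj_on_def)
  then have "{f \<in> ?B. P f} = {f \<in> ?B. P f \<and> f a < f b} \<union> {f \<in> ?B. P f \<and> f b < f a}"
    by (auto simp: neq_iff)
  moreover have "card ({f \<in> ?B. P f \<and> f a < f b} \<union> {f \<in> ?B. P f \<and> f b < f a}) =
      card {f \<in> ?B. P f \<and> f a < f b} + card {f \<in> ?B. P f \<and> f b < f a}"
    using finite_bijections[OF assms(1) V(1)] by (intro card_Un_disjoint) auto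
  ultimately show "real (card {f \<in> ?B. P f \<and> f a < f b}) = c / 2"
    using assms(2) V eq by (auto simp: has_count_def)
qed

section \<open>Spines\<close>

abbreviation upper :: "nat \<Rightarrow> nat \<times> nat" where "upper j \<equiv> (0, j)"
abbreviation lower :: "nat \<Rightarrow> nat \<times> nat" where "lower j \<equiv> (1, j)"

text \<open>The left end \<open>k\<close> is a parameter so that the tree can be grown leftwards
  from column \<open>p\<close>. The node \<open>upper p\<close> does not occur, because its position
  relative to the other late entries depends on the last piece.\<close>

definition spine :: "nat \<Rightarrow> nat \<Rightarrow> (nat \<times> nat \<Rightarrow> nat) \<Rightarrow> bool" where
  "spine k p f \<longleftrightarrow>
     (\<forall>j\<in>{k..<p}. f (lower j) < f (lower (Suc j)) \<and> f (lower (Suc j)) < f (upper j))"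

definition spine_nodes :: "nat \<Rightarrow> nat \<Rightarrow> (nat \<times> nat) set" where
  "spine_nodes k p = lower ` {k..p} \<union> upper ` {k..<p}"

lemma finite_spine_nodes: "finite (spine_nodes k p)"
  by (simp add: spine_nodes_def)

lemma spine_nodes_refl: "spine_nodes p p = {lower p}"
  by (simp add: spine_nodes_def)

lemma spine_nodes_Suc:
  assumes "k < p"
  shows "spine_nodes k p = insert (lower k) (insert (upper k) (spine_nodes (Suc k) p))"
proof -
  have "{k..p} = insert k {Suc k..p}" "{k..<p} = insert k {Suc k..<p}" using assms by auto
  then show ?thesis by (simp add: spine_nodes_def insert_commute)
qed

lemma card_spine_nodes: "k \<le> p \<Longrightarrow> card (spine_nodes k p) = 2 * (p - k) + 1"
  unfolding spine_nodes_def
  by (subst card_Un_disjoint) (auto simp: card_image inj_on_def)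

lemma spine_Suc:
  assumes "k < p"
  shows "spine k p f \<longleftrightarrow>
     f (lower k) < f (lower (Suc k)) \<and> f (lower (Suc k)) < f (upper k) \<and> spine (Suc k) p f"
proof -
  have "{k..<p} = insert k {Suc k..<p}" using assms by auto
  then show ?thesis by (simp add: spine_def)
qed

lemma spine_upd:
  assumes "x \<notin> spine_nodes k p"
  shows "spine k p (f(x := v)) = spine k p f"
proof -
  have "lower j \<noteq> x \<and> lower (Suc j) \<noteq> x \<and> upper j \<noteq> x" if "j \<in> {k..<p}" for j
    using assms that by (auto simp: spine_nodes_def)
  then show ?thesis unfolding spine_def by (intro ball_cong refl) (metis fun_upd_other)
qed

lemma spine_lower_mono:
  assumes "spine k p f" "k \<le> j" "j \<le> p"
  shows "f (lower k) \<le> f (lower j)"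
  using assms(2,3)
proof (induction j rule: dec_induct)
  case (step j)
  then have "f (lower j) < f (lower (Suc j))" using assms(1) by (simp add: spine_def)
  then show ?case using step by simp
qed simp

text \<open>\<open>lower k\<close> is the root of the tree: the lower entries increase from it, and
  each upper entry lies above a lower one.\<close>

lemma spine_min:
  assumes "spine k p f" "x \<in> spine_nodes k p"
  shows "f (lower k) \<le> f x"
proof -
  have "f (lower k) \<le> f (upper j)" if "j \<in> {k..<p}" for j
  proof -
    have "f (lower (Suc j)) < f (upper j)" using assms(1) that by (simp add: spine_def)
    then show ?thesis using spine_lower_mono[OF assms(1), of "Suc j"] that by simp
  qed
  then show ?thesis
    using assms(2) spine_lower_mono[OF assms(1)] by (auto simp: spine_nodes_def)
qed

text \<open>The tree is built from its top part \<open>E\<close> downwards. First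
  \<open>lower p\<close> goes below \<open>E\<close>, as a forced minimum. Each further column puts
  \<open>upper k\<close> anywhere above the current root \<open>lower (Suc k)\<close>, with as many
  choices as there are nodes so far, and then \<open>lower k\<close> below everything, with one
  choice. The number of nodes starts at \<open>card E + 1\<close> and grows by two per column, which
  gives the factors.\<close>

lemma has_count_spine:
  assumes E: "has_count E R c" "finite E" and "E \<inter> spine_nodes k p = {}" "k \<le> p"
    and R: "\<And>f x v. x \<notin> E \<Longrightarrow> R (f(x := v)) = R f"
  shows "has_count (E \<union> spine_nodes k p) (\<lambda>f. R f \<and> (\<forall>e\<in>E. f (lower p) < f e) \<and> spine k p f)
    (c * (\<Prod>i<p - k. real (card E) + 1 + 2 * real i))"
  using assms(4,3)
proof (induction k rule: inc_induct)
  case base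
  have "lower p \<notin> E" using base by (auto simp: spine_nodes_def)
  then have "has_count (insert (lower p) E) (\<lambda>f. R f \<and> (\<forall>e\<in>E. f (lower p) < f e)) c"
    using has_count_min[OF E] R by blast
  then show ?case by (simp add: spine_nodes_refl spine_def)
next
  case (step k)
  let ?J = "E \<union> spine_nodes (Suc k) p"
  let ?P = "\<lambda>k f. R f \<and> (\<forall>e\<in>E. f (lower p) < f e) \<and> spine k p f"
  let ?c = "c * (\<Prod>i<p - Suc k. real (card E) + 1 + 2 * real i)"
  note nodes = spine_nodes_Suc[OF step(2)]
  have disj: "E \<inter> spine_nodes (Suc k) p = {}" "lower k \<notin> E" "upper k \<notin> E"
    using step(4) nodes by auto
  have fin: "finite ?J" using E(2) finite_spine_nodes by simp
  have new: "upper k \<notin> ?J" "lower k \<notin> insert (upper k) ?J"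
    using disj by (auto simp: spine_nodes_def)
  have root: "lower (Suc k) \<in> ?J" using step(2) by (auto simp: spine_nodes_def)
  have min: "f (lower (Suc k)) \<le> f x" if P: "?P (Suc k) f" and x: "x \<in> ?J" for f x
  proof (cases "x \<in> E")
    case True
    then have "f (lower p) < f x" using P by blast
    then show ?thesis using spine_lower_mono[of "Suc k" p f p] P step(2) by simp
  qed (use spine_min P x in blast)
  have inv: "?P (Suc k) (f(x := v)) = ?P (Suc k) f" if "x \<notin> ?J" for f x v
  proof -
    have "lower p \<in> spine_nodes (Suc k) p" using step(2) by (auto simp: spine_nodes_def)
    then have "x \<noteq> lower p" using that by blast
    moreover have "(\<forall>e\<in>E. y < (f(x := v)) e) \<longleftrightarrow> (\<forall>e\<in>E. y < f e)" for y
      using that by auto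
    ultimately show ?thesis using that R spine_upd[of x "Suc k" p f v] by simp
  qed
  have "has_count (insert (upper k) ?J) (\<lambda>f. ?P (Suc k) f \<and> f (lower (Suc k)) < f (upper k))
      (real (card ?J) * ?c)"
    by (rule has_count_above_min[OF step.IH[OF disj(1)] fin new(1) inv[OF new(1)] root min])
  then have "has_count (insert (lower k) (insert (upper k) ?J))
      (\<lambda>f. (?P (Suc k) f \<and> f (lower (Suc k)) < f (upper k)) \<and>
        (\<forall>x\<in>insert (upper k) ?J. f (lower k) < f x)) (real (card ?J) * ?c)"
    by (rule has_count_min) (use fin new inv[of "lower k"] in simp_all)
  \<comment> \<open>Being below every node amounts to
    \<open>f (lower k) < f (lower (Suc k))\<close>, as \<open>lower (Suc k)\<close> was the minimum
    so far and \<open>upper k\<close> lies above it.\<close>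
  then have "has_count (insert (lower k) (insert (upper k) ?J)) (?P k) (real (card ?J) * ?c)"
  proof (rule has_count_cong)
    fix f :: "nat \<times> nat \<Rightarrow> nat"
    show "?P k f \<longleftrightarrow> (?P (Suc k) f \<and> f (lower (Suc k)) < f (upper k)) \<and>
        (\<forall>x\<in>insert (upper k) ?J. f (lower k) < f x)"
    proof
      assume P: "?P k f"
      then have P': "?P (Suc k) f" and *: "f (lower k) < f (lower (Suc k))"
          "f (lower (Suc k)) < f (upper k)"
        using spine_Suc[OF step(2), of f] by blast+
      then have "f (lower k) < f x" if "x \<in> ?J" for x
        using min[OF P' that] by simp
      then show "(?P (Suc k) f \<and> f (lower (Suc k)) < f (upper k)) \<and>
          (\<forall>x\<in>insert (upper k) ?J. f (lower k) < f x)"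
        using P' * by simp
    next
      assume "(?P (Suc k) f \<and> f (lower (Suc k)) < f (upper k)) \<and>
        (\<forall>x\<in>insert (upper k) ?J. f (lower k) < f x)"
      then show "?P k f"
        using spine_Suc[OF step(2), of f] root by blast
    qed
  qed
  moreover have "insert (lower k) (insert (upper k) ?J) = E \<union> spine_nodes k p"
    using nodes by auto
  \<comment> \<open>The new column contributes the factor with index
    \<open>i = p - Suc k\<close>.\<close>
  moreover have "real (card ?J) * ?c = c * (\<Prod>i<p - k. real (card E) + 1 + 2 * real i)"
  proof -
    have "real (card ?J) = real (card E) + 1 + 2 * real (p - Suc k)"
      using card_Un_disjoint[OF E(2) finite_spine_nodes disj(1)] card_spine_nodes[of "Suc k" p]
        step(2) by simp
    moreover have "p - k = Suc (p - Suc k)" using step(2) by simp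
    ultimately show ?thesis by simp
  qed
  ultimately show ?case by simp
qed

text \<open>The factors start at \<open>m + 1\<close> and go up in steps of two, so they continue
  the double factorial of \<open>m - 1\<close>. It is applied with \<open>m = card E\<close>, and
  the parity of \<open>m\<close> decides whether odd or even double factorials appear.\<close>

lemma prod_double_fact:
  "m \<ge> 1 \<Longrightarrow>
     real (double_fact (m - 1)) * (\<Prod>i<p. real m + 1 + 2 * real i) = real (double_fact (m - 1 + 2 * p))"
proof (induction p)
  case (Suc p)
  define k where "k = m - 1 + 2 * p"
  have k: "real k + 2 = real m + 1 + 2 * real p" using Suc.prems by (simp add: k_def of_nat_diff)
  have "real (double_fact (m - 1)) * (\<Prod>i<Suc p. real m + 1 + 2 * real i) =
      (real k + 2) * real (double_fact k)"
    using Suc.IH[OF Suc.prems] unfolding k k_def[symmetric] prod.lessThan_Suc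
    by (simp only: mult.assoc[symmetric]) (simp only: mult.commute)
  also have "\<dots> = real (double_fact (Suc (Suc k)))"
    by (simp add: algebra_simps)
  also have "Suc (Suc k) = m - 1 + 2 * Suc p" by (simp add: k_def)
  finally show ?case .
qed simp

section \<open>Constraints on two or three nodes\<close>

lemma has_count_less:
  assumes "a \<noteq> b"
  shows "has_count {a, b} (\<lambda>f. f a < f b) 1"
  using has_count_min[OF has_count_singleton[of b], of a] assms by simp

lemma has_count_less_less:
  assumes "distinct [a, b, c]"
  shows "has_count {a, b, c} (\<lambda>f. f a < f b \<and> f b < f c) 1"
proof -
  have "has_count {a, b, c} (\<lambda>f. f b < f c \<and> (\<forall>x\<in>{b, c}. f a < f x)) 1"
    by (rule has_count_min[OF has_count_less]) (use assms in auto)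
  then show ?thesis by (rule has_count_cong) auto
qed

lemma has_count_less_free:
  assumes "distinct [a, b, c]"
  shows "has_count {a, b, c} (\<lambda>f. f a < f b) 3"
proof -
  have "has_count (insert c {a, b}) (\<lambda>f. f a < f b) ((real (card {a, b}) + 1) * 1)"
    by (rule has_count_free[OF has_count_less]) (use assms in auto)
  then show ?thesis using assms by (simp add: insert_commute)
qed

lemma has_count_pair:
  assumes "a \<noteq> b"
  shows "has_count {a, b} (\<lambda>_. True) 2"
  using has_count_free[OF has_count_singleton[of a], of b] assms by (simp add: insert_commute)

section \<open>Reductions of pieces\<close>

lemma card_standard_puzzles_Collect:
  "card {M \<in> standard_puzzles n. Q M} =
   card {f \<in> bijections ({0..<2} \<times> {0..<n + 1}) {1..2 * n + 2}. Q (mat 2 (n + 1) f)}"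
proof (rule bij_betw_same_card)
  let ?G = "{0..<2} \<times> {0..<n + 1} :: (nat \<times> nat) set"
  \<comment> \<open>The restriction to the grid makes the entry function extensional, so that it
    determines the matrix and conversely.\<close>
  let ?h = "\<lambda>M :: nat mat. restrict (\<lambda>ij. M $$ ij) ?G"
  have mat_h: "mat 2 (n + 1) (?h M) = M" if "M \<in> standard_puzzles n" for M
    using that by (intro eq_matI) (auto simp: standard_puzzles_def)
  have h_mat: "?h (mat 2 (n + 1) f) = f" if "f \<in> bijections ?G {1..2 * n + 2}" for f
    using that by (auto simp: bijections_def extensional_def fun_eq_iff)
  have h: "?h M \<in> bijections ?G {1..2 * n + 2}" if "M \<in> standard_puzzles n" for M
    using that by (simp add: bijections_def standard_puzzles_def)
  have mat: "mat 2 (n + 1) f \<in> standard_puzzles n" if "f \<in> bijections ?G {1..2 * n + 2}" for f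
  proof -
    have "bij_betw (\<lambda>ij. mat 2 (n + 1) f $$ ij) ?G {1..2 * n + 2} \<longleftrightarrow>
        bij_betw f ?G {1..2 * n + 2}"
      by (rule bij_betw_cong) auto
    then show ?thesis using that by (simp add: bijections_def standard_puzzles_def)
  qed
  show "bij_betw ?h {M \<in> standard_puzzles n. Q M}
      {f \<in> bijections ?G {1..2 * n + 2}. Q (mat 2 (n + 1) f)}"
    by (rule bij_betw_byWitness[where f' = "mat 2 (n + 1)"])
      (use mat_h h_mat h mat in \<open>auto simp del: restrict_apply\<close>)
qed

lemma is_support_iff:
  "is_support \<P> (mat 2 (n + 1) f) \<longleftrightarrow>
   (\<forall>j<n. reduction (mat_of_rows_list 2
      [[f (upper j), f (upper (Suc j))], [f (lower j), f (lower (Suc j))]]) \<in> \<P>)"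
proof -
  have piece: "submatrix (mat 2 (n + 1) f) UNIV {j, j + 1} = mat_of_rows_list 2
      [[f (upper j), f (upper (Suc j))], [f (lower j), f (lower (Suc j))]]" if "j < n" for j
  proof -
    have "submatrix (mat 2 (n + 1) f) UNIV {j, j + 1} =
        mat 2 2 (\<lambda>(i, k). mat 2 (n + 1) f $$ (i, j + k))"
      by (rule piece_eq[of _ "n + 1"]) (use that in auto)
    also have "\<dots> = mat 2 2 (\<lambda>(i, k). f (i, j + k))"
      by (rule cong_mat) (use that in auto)
    also have "\<dots> = mat_of_rows_list 2
        [[f (upper j), f (upper (Suc j))], [f (lower j), f (lower (Suc j))]]"
      by (intro eq_matI) (auto simp: mat_of_rows_list_def less_Suc_eq numeral_2_eq_2)
    finally show ?thesis .
  qed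
  have "pieces (mat 2 (n + 1) f) =
      (\<lambda>j. submatrix (mat 2 (n + 1) f) UNIV {j, j + 1}) ` {..<n}"
    by (auto simp: pieces_def)
  then show ?thesis using piece by (auto simp: is_support_def)
qed

lemma elements_mat_2_2: "elements_mat (mat_of_rows_list 2 [[a, b], [c, d]]) = {a, b, c, d}"
  by (simp add: elements_mat_def mat_of_rows_list_def numeral_2_eq_2 insert_commute)

lemma mat_2_2_eq_iff:
  "mat_of_rows_list 2 [[a, b], [c, d]] = mat_of_rows_list 2 [[a', b'], [c', d']] \<longleftrightarrow>
   a = a' \<and> b = b' \<and> c = c' \<and> d = d'" (is "?A = ?B \<longleftrightarrow> _")
proof
  assume "?A = ?B"
  then have "?A $$ (i, j) = ?B $$ (i, j)" for i j by simp
  from this[of 0 0] this[of 0 1] this[of 1 0] this[of 1 1]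
  show "a = a' \<and> b = b' \<and> c = c' \<and> d = d'" by (simp add: mat_of_rows_list_def)
qed simp

lemma map_mat_2_2:
  "map_mat f (mat_of_rows_list 2 [[a, b], [c, d]]) = mat_of_rows_list 2 [[f a, f b], [f c, f d]]"
  by (intro eq_matI) (auto simp: mat_of_rows_list_def less_Suc_eq numeral_2_eq_2)

text \<open>The rank is written as a sum of four indicators, so that known inequalities evaluate it
  by simplification. It is a parameter \<open>r\<close> so that a caller can keep its own rank
  function folded.\<close>

lemma reduction_eq_iff:
  fixes a b c d :: nat
  assumes "distinct [a, b, c, d]"
    and r: "\<And>x. r x = of_bool (a \<le> x) + of_bool (b \<le> x) + of_bool (c \<le> x) + of_bool (d \<le> x)"
  shows "reduction (mat_of_rows_list 2 [[a, b], [c, d]]) = mat_of_rows_list 2 [[a', b'], [c', d']]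
    \<longleftrightarrow> r a = a' \<and> r b = b' \<and> r c = c' \<and> r d = d'"
proof -
  have "card {y \<in> {a, b, c, d}. y \<le> x} = r x" for x
  proof -
    have "card {y \<in> {a, b, c, d}. y \<le> x} = (\<Sum>y\<in>{a, b, c, d}. of_bool (y \<le> x))"
      by (subst sum_of_bool_eq) (simp_all add: Int_def)
    then show ?thesis using assms by (simp add: add.assoc)
  qed
  then show ?thesis
    by (simp only: reduction_def elements_mat_2_2 map_mat_2_2 mat_2_2_eq_iff)
qed

lemma reduction_piece_iffs:
  fixes u u' l l' :: nat
  assumes "distinct [u, u', l, l']"
  defines "P \<equiv> mat_of_rows_list 2 [[u, u'], [l, l']]"
  shows "reduction P = A1 \<longleftrightarrow> l < l' \<and> l' < u' \<and> u' < u"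
    "reduction P = A2 \<longleftrightarrow> l < l' \<and> l' < u \<and> u < u'"
    "reduction P = B1 \<longleftrightarrow> l < u' \<and> u' < l' \<and> l' < u"
    "reduction P = B2 \<longleftrightarrow> l < u' \<and> u' < u \<and> u < l'"
    "reduction P = B3 \<longleftrightarrow> l < u \<and> u < u' \<and> u' < l'"
    "reduction P = B4 \<longleftrightarrow> u' < l \<and> l < u \<and> u < l'"
    "reduction P = B5 \<longleftrightarrow> u' < l \<and> l < l' \<and> l' < u"
    "reduction P = B6 \<longleftrightarrow> u' < l' \<and> l' < l \<and> l < u"
proof -
  define r :: "nat \<Rightarrow> nat" where
    "r x = of_bool (u \<le> x) + of_bool (u' \<le> x) + of_bool (l \<le> x) + of_bool (l' \<le> x)" for x
  \<comment> \<open>Ranks are monotone, so prescribed ranks determine the order of the entries.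
    Conversely, the order evaluates every indicator in \<open>r_def\<close>.\<close>
  have less: "x < y" if "r x < r y" for x y
  proof (rule ccontr)
    assume "\<not> x < y"
    then have "r y \<le> r x" unfolding r_def by (intro add_mono) auto
    then show False using that by simp
  qed
  note red = reduction_eq_iff[OF assms(1) r_def, folded P_def]
  show "reduction P = A1 \<longleftrightarrow> l < l' \<and> l' < u' \<and> u' < u"
    unfolding A1_def red by (rule iffI, simp add: less, simp add: r_def)
  show "reduction P = A2 \<longleftrightarrow> l < l' \<and> l' < u \<and> u < u'"
    unfolding A2_def red by (rule iffI, simp add: less, simp add: r_def)
  show "reduction P = B1 \<longleftrightarrow> l < u' \<and> u' < l' \<and> l' < u"
    unfolding B1_def red by (rule iffI, simp add: less, simp add: r_def)
  show "reduction P = B2 \<longleftrightarrow> l < u' \<and> u' < u \<and> u < l'"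
    unfolding B2_def red by (rule iffI, simp add: less, simp add: r_def)
  show "reduction P = B3 \<longleftrightarrow> l < u \<and> u < u' \<and> u' < l'"
    unfolding B3_def red by (rule iffI, simp add: less, simp add: r_def)
  show "reduction P = B4 \<longleftrightarrow> u' < l \<and> l < u \<and> u < l'"
    unfolding B4_def red by (rule iffI, simp add: less, simp add: r_def)
  show "reduction P = B5 \<longleftrightarrow> u' < l \<and> l < l' \<and> l' < u"
    unfolding B5_def red by (rule iffI, simp add: less, simp add: r_def)
  show "reduction P = B6 \<longleftrightarrow> u' < l' \<and> l' < l \<and> l < u"
    unfolding B6_def red by (rule iffI, simp add: less, simp add: r_def)
qed

text \<open>\<open>A1\<close> and \<open>A2\<close> differ only in the order of the two top entries,
  and allowing both leaves that order free.\<close>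

lemma reduction_Q_iff:
  assumes "distinct [u, u', l, l']"
  shows "reduction (mat_of_rows_list 2 [[u, u'], [l, l']]) \<in> Q_pieces \<longleftrightarrow>
    l < l' \<and> l' < u \<and> l' < u'"
  using assms by (auto simp: Q_pieces_def reduction_piece_iffs)

section \<open>Constraints on the last piece\<close>

text \<open>These are the entries whose order is governed by the last piece. Together with the spine
  up to column \<open>p\<close> they fill the grid of a puzzle with \<open>Suc p\<close>
  pieces.\<close>

definition last_nodes :: "nat \<Rightarrow> (nat \<times> nat) set" where
  "last_nodes p = {upper p, upper (Suc p), lower (Suc p)}"

lemma last_nodes_disjoint: "last_nodes p \<inter> spine_nodes 0 p = {}"
  by (auto simp: last_nodes_def spine_nodes_def)

lemma finite_last_nodes: "finite (last_nodes p)"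
  by (simp add: last_nodes_def)

lemma card_last_nodes: "card (last_nodes p) = 3"
  by (simp add: last_nodes_def)

lemma double_fact_2: "double_fact 2 = 2"
  by (simp add: numeral_2_eq_2)

lemma grid_eq: "{0..<2} \<times> {0..<Suc p + 1} = last_nodes p \<union> spine_nodes 0 p"
  by (auto simp: last_nodes_def spine_nodes_def less_Suc_eq numeral_2_eq_2)

text \<open>\<open>E\<close> consists only of the last nodes required to lie above
  \<open>lower p\<close>; the remaining ones are added afterwards without constraint by
  \<open>has_count_insert_last\<close>.\<close>

lemma has_count_last:
  assumes "has_count E R c" "E \<subseteq> last_nodes p" "E \<noteq> {}"
    and R: "\<And>f x v. x \<notin> E \<Longrightarrow> R (f(x := v)) = R f"
  shows "has_count (E \<union> spine_nodes 0 p) (\<lambda>f. R f \<and> (\<forall>e\<in>E. f (lower p) < f e) \<and> spine 0 p f)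
    (c * real (double_fact (card E - 1 + 2 * p)) / real (double_fact (card E - 1)))"
proof -
  have E: "finite E" "E \<inter> spine_nodes 0 p = {}"
    using assms(2) last_nodes_disjoint finite_last_nodes finite_subset by blast+
  then have "card E \<ge> 1" using assms(3) by (simp add: Suc_le_eq card_gt_0_iff)
  moreover have "double_fact k > 0" for k by (induction k rule: double_fact.induct) auto
  ultimately have "(\<Prod>i<p. real (card E) + 1 + 2 * real i) =
      real (double_fact (card E - 1 + 2 * p)) / real (double_fact (card E - 1))"
    using prod_double_fact[of "card E" p] by (simp add: field_simps)
  then show ?thesis
    using has_count_spine[OF assms(1) E(1) E(2) _ R] by simp
qed

text \<open>All three last nodes lie above \<open>lower p\<close>. Among them
  \<open>lower (Suc p)\<close> is least and the other two are unordered, so there are two solutions,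
  which cancel the denominator \<open>double_fact 2\<close>.\<close>

lemma has_count_Q:
  "has_count (last_nodes p \<union> spine_nodes 0 p)
    (\<lambda>f. spine 0 p f \<and> f (lower p) < f (lower (Suc p)) \<and> f (lower (Suc p)) < f (upper p) \<and>
      f (lower (Suc p)) < f (upper (Suc p)))
    (real (double_fact (2 * p + 2)))"
proof -
  let ?R = "\<lambda>f :: nat \<times> nat \<Rightarrow> nat.
    True \<and> (\<forall>x\<in>{upper p, upper (Suc p)}. f (lower (Suc p)) < f x)"
  have "has_count (insert (lower (Suc p)) {upper p, upper (Suc p)}) ?R 2"
    by (rule has_count_min[OF has_count_pair]) auto
  moreover have "insert (lower (Suc p)) {upper p, upper (Suc p)} = last_nodes p"
    by (auto simp: last_nodes_def)
  ultimately have "has_count (last_nodes p) ?R 2" by simp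
  then have "has_count (last_nodes p \<union> spine_nodes 0 p)
      (\<lambda>f. ?R f \<and> (\<forall>e\<in>last_nodes p. f (lower p) < f e) \<and> spine 0 p f)
      (2 * real (double_fact (card (last_nodes p) - 1 + 2 * p)) /
        real (double_fact (card (last_nodes p) - 1)))"
    by (rule has_count_last) (auto simp: last_nodes_def)
  then have "has_count (last_nodes p \<union> spine_nodes 0 p)
      (\<lambda>f. ?R f \<and> (\<forall>e\<in>last_nodes p. f (lower p) < f e) \<and> spine 0 p f)
      (real (double_fact (2 * p + 2)))"
    unfolding card_last_nodes by (simp add: double_fact_2 add.commute del: double_fact.simps)
  then show ?thesis
    by (rule has_count_cong) (auto simp: last_nodes_def)
qed

text \<open>A chain of the three last nodes above \<open>lower p\<close> has one solution. The last
  pieces \<open>B1\<close>, \<open>B2\<close> and \<open>B3\<close> are the cases of this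
  kind.\<close>

lemma has_count_last_chain:
  assumes "{a, b, c} = last_nodes p"
  shows "has_count (last_nodes p \<union> spine_nodes 0 p)
    (\<lambda>f. spine 0 p f \<and> f (lower p) < f a \<and> f a < f b \<and> f b < f c)
    (real (double_fact (2 * p + 2)) / 2)"
proof -
  have card: "card {a, b, c} = 3" unfolding assms by (rule card_last_nodes)
  then have "distinct [a, b, c]" by (auto simp: card_insert_if split: if_splits)
  then have "has_count ({a, b, c} \<union> spine_nodes 0 p)
      (\<lambda>f. (f a < f b \<and> f b < f c) \<and> (\<forall>e\<in>{a, b, c}. f (lower p) < f e) \<and> spine 0 p f)
      (1 * real (double_fact (card {a, b, c} - 1 + 2 * p)) / real (double_fact (card {a, b, c} - 1)))"
    by (intro has_count_last[OF has_count_less_less]) (use assms in auto)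
  then have "has_count ({a, b, c} \<union> spine_nodes 0 p)
      (\<lambda>f. (f a < f b \<and> f b < f c) \<and> (\<forall>e\<in>{a, b, c}. f (lower p) < f e) \<and> spine 0 p f)
      (real (double_fact (2 * p + 2)) / 2)"
    unfolding card by (simp add: double_fact_2 add.commute del: double_fact.simps)
  then show ?thesis
    unfolding assms[symmetric] by (rule has_count_cong) auto
qed

text \<open>Here \<open>c\<close> may take any place relative to \<open>a < b\<close>, hence three
  solutions. This count is what gets subtracted when a condition is complemented.\<close>

lemma has_count_last_less:
  assumes "{a, b, c} = last_nodes p"
  shows "has_count (last_nodes p \<union> spine_nodes 0 p)
    (\<lambda>f. spine 0 p f \<and> f (lower p) < f c \<and> f (lower p) < f a \<and> f a < f b)
    (3 / 2 * real (double_fact (2 * p + 2)))"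
proof -
  have card: "card {a, b, c} = 3" unfolding assms by (rule card_last_nodes)
  then have "distinct [a, b, c]" by (auto simp: card_insert_if split: if_splits)
  then have "has_count ({a, b, c} \<union> spine_nodes 0 p)
      (\<lambda>f. f a < f b \<and> (\<forall>e\<in>{a, b, c}. f (lower p) < f e) \<and> spine 0 p f)
      (3 * real (double_fact (card {a, b, c} - 1 + 2 * p)) / real (double_fact (card {a, b, c} - 1)))"
    by (intro has_count_last[OF has_count_less_free]) (use assms in auto)
  then have "has_count ({a, b, c} \<union> spine_nodes 0 p)
      (\<lambda>f. f a < f b \<and> (\<forall>e\<in>{a, b, c}. f (lower p) < f e) \<and> spine 0 p f)
      (3 / 2 * real (double_fact (2 * p + 2)))"
    unfolding card by (simp add: double_fact_2 add.commute del: double_fact.simps)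
  then show ?thesis
    unfolding assms[symmetric] by (rule has_count_cong) auto
qed

lemma has_count_insert_last:
  assumes "has_count (E \<union> spine_nodes 0 p) (\<lambda>f. R f \<and> spine 0 p f) c"
    and "insert x E \<subseteq> last_nodes p" "x \<notin> E" and R: "\<And>f v. R (f(x := v)) = R f"
  shows "has_count (insert x E \<union> spine_nodes 0 p) (\<lambda>f. R f \<and> spine 0 p f)
    ((real (card E) + 2 * real p + 2) * c)"
proof -
  have "finite E" using assms(2) finite_subset[OF _ finite_last_nodes, of E] by blast
  moreover have "E \<inter> spine_nodes 0 p = {}" "x \<notin> spine_nodes 0 p"
    using assms(2) last_nodes_disjoint[of p] by blast+
  ultimately have E: "finite E" "E \<inter> spine_nodes 0 p = {}" "x \<notin> spine_nodes 0 p" .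
  have "has_count (insert x (E \<union> spine_nodes 0 p)) (\<lambda>f. R f \<and> spine 0 p f)
      ((real (card (E \<union> spine_nodes 0 p)) + 1) * c)"
  proof (rule has_count_free[OF assms(1)])
    show "finite (E \<union> spine_nodes 0 p)" using E(1) finite_spine_nodes by blast
    show "x \<notin> E \<union> spine_nodes 0 p" using E(3) assms(3) by blast
  qed (simp only: R spine_upd[OF E(3)])
  moreover have "card (E \<union> spine_nodes 0 p) = card E + 2 * p + 1"
    using card_Un_disjoint[OF E(1) finite_spine_nodes E(2)] card_spine_nodes[of 0 p] by simp
  ultimately show ?thesis by (simp add: algebra_simps)
qed

text \<open>With \<open>c\<close> below \<open>lower p\<close> the constraints no longer form a tree
  rooted at \<open>lower 0\<close>. Instead \<open>c\<close> is first left free, which multiplies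
  the count \<open>double_fact (2 * p + 1)\<close> for the tree over \<open>a < b\<close> by
  \<open>2 * p + 4\<close>; then the fillings with \<open>c\<close> above \<open>lower p\<close> are
  removed.\<close>

lemma has_count_below:
  assumes "{a, b, c} = last_nodes p"
  shows "has_count (last_nodes p \<union> spine_nodes 0 p)
    (\<lambda>f. spine 0 p f \<and> f c < f (lower p) \<and> f (lower p) < f a \<and> f a < f b)
    ((2 * real p + 4) * real (double_fact (2 * p + 1)) - 3 / 2 * real (double_fact (2 * p + 2)))"
proof -
  have card: "card {a, b, c} = 3" unfolding assms by (rule card_last_nodes)
  then have dist: "distinct [a, b, c]" by (auto simp: card_insert_if split: if_splits)
  then have ab: "a \<noteq> b" by simp
  have mem: "a \<in> last_nodes p" "b \<in> last_nodes p" "c \<in> last_nodes p"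
    unfolding assms[symmetric] by simp_all
  then have "lower p \<noteq> c" by (auto simp: last_nodes_def)
  let ?R = "\<lambda>f :: nat \<times> nat \<Rightarrow> nat. f a < f b \<and> (\<forall>e\<in>{a, b}. f (lower p) < f e)"
  have "has_count ({a, b} \<union> spine_nodes 0 p)
      (\<lambda>f. f a < f b \<and> (\<forall>e\<in>{a, b}. f (lower p) < f e) \<and> spine 0 p f)
      (1 * real (double_fact (card {a, b} - 1 + 2 * p)) / real (double_fact (card {a, b} - 1)))"
    by (rule has_count_last[OF has_count_less[OF ab]]) (use mem in auto)
  then have "has_count ({a, b} \<union> spine_nodes 0 p) (\<lambda>f. ?R f \<and> spine 0 p f)
      (real (double_fact (2 * p + 1)))"
    using ab by simp
  then have "has_count (insert c {a, b} \<union> spine_nodes 0 p) (\<lambda>f. ?R f \<and> spine 0 p f)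
      ((real (card {a, b}) + 2 * real p + 2) * real (double_fact (2 * p + 1)))"
    by (rule has_count_insert_last) (use mem dist \<open>lower p \<noteq> c\<close> in auto)
  moreover have "insert c {a, b} = last_nodes p" unfolding assms[symmetric] by blast
  ultimately have free: "has_count (last_nodes p \<union> spine_nodes 0 p) (\<lambda>f. ?R f \<and> spine 0 p f)
      ((2 * real p + 4) * real (double_fact (2 * p + 1)))"
    using ab by (simp add: algebra_simps)
  have fin: "finite (last_nodes p \<union> spine_nodes 0 p)"
    using finite_last_nodes finite_spine_nodes by simp
  have "has_count (last_nodes p \<union> spine_nodes 0 p)
      (\<lambda>f. (?R f \<and> spine 0 p f) \<and> f (lower p) < f c) (3 / 2 * real (double_fact (2 * p + 2)))"
    by (rule has_count_cong[OF has_count_last_less[OF assms]]) auto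
  from has_count_diff[OF fin free this] show ?thesis
  proof (rule has_count_cong)
    fix f :: "nat \<times> nat \<Rightarrow> nat" assume inj: "inj_on f (last_nodes p \<union> spine_nodes 0 p)"
    have "lower p \<in> spine_nodes 0 p" by (auto simp: spine_nodes_def)
    then have "f (lower p) \<noteq> f c"
      using inj mem(3) \<open>lower p \<noteq> c\<close> by (metis UnCI inj_on_contraD)
    then show "(spine 0 p f \<and> f c < f (lower p) \<and> f (lower p) < f a \<and> f a < f b) \<longleftrightarrow>
        (?R f \<and> spine 0 p f) \<and> \<not> f (lower p) < f c"
      by auto
  qed
qed

text \<open>Write \<open>u, l\<close> for column \<open>p\<close> and \<open>u', l'\<close> for column \<open>p + 1\<close>.
  Without \<open>l' < l\<close> the condition \<open>u' < l'\<close> holds for half of the fillings, by symmetry; the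
  fillings with \<open>u' < l'\<close> and \<open>l < l'\<close> are those with \<open>l < l'\<close> except those with \<open>l < l' < u'\<close>.\<close>
lemma has_count_B6:
  "has_count (last_nodes p \<union> spine_nodes 0 p)
    (\<lambda>f. spine 0 p f \<and> f (upper (Suc p)) < f (lower (Suc p)) \<and>
      f (lower (Suc p)) < f (lower p) \<and> f (lower p) < f (upper p))
    ((2 * real p + 3) * (real p + 2) * real (double_fact (2 * p))
      - ((4 * real p + 8) * real (double_fact (2 * p + 1)) - 3 / 2 * real (double_fact (2 * p + 2))))"
proof -
  let ?u = "upper p" and ?u' = "upper (Suc p)" and ?l = "lower p" and ?l' = "lower (Suc p)"
  let ?I = "last_nodes p \<union> spine_nodes 0 p"
  have fin: "finite ?I" using finite_last_nodes finite_spine_nodes by simp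
  have last: "insert ?u' {?u, ?l'} = last_nodes p" "insert ?u' {?l', ?u} = last_nodes p"
    "{?l', ?u', ?u} = last_nodes p"
    by (auto simp: last_nodes_def)
  have mem: "?u' \<in> ?I" "?l' \<in> ?I" "?l \<in> ?I"
    by (auto simp: last_nodes_def spine_nodes_def)
  have "has_count ({?u} \<union> spine_nodes 0 p)
      (\<lambda>f. True \<and> (\<forall>e\<in>{?u}. f ?l < f e) \<and> spine 0 p f)
      (1 * real (double_fact (card {?u} - 1 + 2 * p)) / real (double_fact (card {?u} - 1)))"
    by (rule has_count_last[OF has_count_singleton]) (auto simp: last_nodes_def)
  then have "has_count ({?u} \<union> spine_nodes 0 p) (\<lambda>f. f ?l < f ?u \<and> spine 0 p f)
      (real (double_fact (2 * p)))"
    by simp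
  then have "has_count ({?l', ?u} \<union> spine_nodes 0 p) (\<lambda>f. f ?l < f ?u \<and> spine 0 p f)
      ((real (card {?u}) + 2 * real p + 2) * real (double_fact (2 * p)))"
    by (rule has_count_insert_last) (auto simp: last_nodes_def)
  then have "has_count (insert ?u' {?l', ?u} \<union> spine_nodes 0 p) (\<lambda>f. f ?l < f ?u \<and> spine 0 p f)
      ((real (card {?l', ?u}) + 2 * real p + 2) *
        ((real (card {?u}) + 2 * real p + 2) * real (double_fact (2 * p))))"
    by (rule has_count_insert_last) (auto simp: last_nodes_def)
  then have "has_count ?I (\<lambda>f. f ?l < f ?u \<and> spine 0 p f)
      (2 * ((2 * real p + 3) * (real p + 2) * real (double_fact (2 * p))))"
    unfolding last by (simp add: algebra_simps)
  \<comment> \<open>Both \<open>?u'\<close> and \<open>?l'\<close> are still free here, so the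
    transposition argument applies; the factor 2 was pulled out beforehand to cancel against the
    halving.\<close>
  then have "has_count ?I (\<lambda>f. (f ?l < f ?u \<and> spine 0 p f) \<and> f ?u' < f ?l')
      (2 * ((2 * real p + 3) * (real p + 2) * real (double_fact (2 * p))) / 2)"
    using mem by (intro has_count_symmetric[OF fin])
      (auto simp: spine_def Transposition.transpose_def)
  then have all: "has_count ?I (\<lambda>f. (f ?l < f ?u \<and> spine 0 p f) \<and> f ?u' < f ?l')
      ((2 * real p + 3) * (real p + 2) * real (double_fact (2 * p)))"
    by simp
  have "has_count ({?u, ?l'} \<union> spine_nodes 0 p)
      (\<lambda>f. True \<and> (\<forall>e\<in>{?u, ?l'}. f ?l < f e) \<and> spine 0 p f)
      (2 * real (double_fact (card {?u, ?l'} - 1 + 2 * p)) / real (double_fact (card {?u, ?l'} - 1)))"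
    by (rule has_count_last[OF has_count_pair]) (auto simp: last_nodes_def)
  then have "has_count ({?u, ?l'} \<union> spine_nodes 0 p)
      (\<lambda>f. (f ?l < f ?u \<and> f ?l < f ?l') \<and> spine 0 p f) (2 * real (double_fact (2 * p + 1)))"
    by simp
  then have "has_count (insert ?u' {?u, ?l'} \<union> spine_nodes 0 p)
      (\<lambda>f. (f ?l < f ?u \<and> f ?l < f ?l') \<and> spine 0 p f)
      ((real (card {?u, ?l'}) + 2 * real p + 2) * (2 * real (double_fact (2 * p + 1))))"
    by (rule has_count_insert_last) (auto simp: last_nodes_def)
  then have free: "has_count ?I (\<lambda>f. (f ?l < f ?u \<and> f ?l < f ?l') \<and> spine 0 p f)
      ((4 * real p + 8) * real (double_fact (2 * p + 1)))"
    unfolding last by (simp add: algebra_simps)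
  have "has_count ?I (\<lambda>f. ((f ?l < f ?u \<and> f ?l < f ?l') \<and> spine 0 p f) \<and> f ?l' < f ?u')
      (3 / 2 * real (double_fact (2 * p + 2)))"
    by (rule has_count_cong[OF has_count_last_less[OF last(3)]]) auto
  from has_count_diff[OF fin free this]
  have "has_count ?I (\<lambda>f. ((f ?l < f ?u \<and> spine 0 p f) \<and> f ?u' < f ?l') \<and> f ?l < f ?l')
      ((4 * real p + 8) * real (double_fact (2 * p + 1)) - 3 / 2 * real (double_fact (2 * p + 2)))"
  proof (rule has_count_cong)
    fix f :: "nat \<times> nat \<Rightarrow> nat" assume "inj_on f ?I"
    then have "f ?u' \<noteq> f ?l'" using mem by (auto dest: inj_onD)
    then show "((f ?l < f ?u \<and> spine 0 p f) \<and> f ?u' < f ?l') \<and> f ?l < f ?l' \<longleftrightarrow>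
        ((f ?l < f ?u \<and> f ?l < f ?l') \<and> spine 0 p f) \<and> \<not> f ?l' < f ?u'"
      by auto
  qed
  from has_count_diff[OF fin all this] show ?thesis
  proof (rule has_count_cong)
    fix f :: "nat \<times> nat \<Rightarrow> nat" assume "inj_on f ?I"
    then have "f ?l \<noteq> f ?l'" using mem by (auto dest: inj_onD)
    then show "(spine 0 p f \<and> f ?u' < f ?l' \<and> f ?l' < f ?l \<and> f ?l < f ?u) \<longleftrightarrow>
        ((f ?l < f ?u \<and> spine 0 p f) \<and> f ?u' < f ?l') \<and> \<not> f ?l < f ?l'"
      by auto
  qed
qed

text \<open>The order pattern of the extra piece is abstracted to \<open>C\<close>, with arguments
  column by column and the lower entry first, so that all six pieces share one argument. The summand
  \<open>double_fact (2 * p + 2)\<close> counts the puzzles over \<open>A1\<close>,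
  \<open>A2\<close> alone, and \<open>d\<close> those ending in \<open>X\<close>.\<close>

lemma s_count_add_piece:
  fixes C :: "nat \<Rightarrow> nat \<Rightarrow> nat \<Rightarrow> nat \<Rightarrow> bool"
  assumes red: "\<And>u u' l l'. distinct [u, u', l, l'] \<Longrightarrow>
      reduction (mat_of_rows_list 2 [[u, u'], [l, l']]) = X \<longleftrightarrow> C l u l' u'"
    and C: "\<And>l u l' u'. C l u l' u' \<Longrightarrow> l < u \<and> u' < l'"
    and count: "has_count (last_nodes p \<union> spine_nodes 0 p)
      (\<lambda>f. spine 0 p f \<and> C (f (lower p)) (f (upper p)) (f (lower (Suc p))) (f (upper (Suc p)))) d"
  shows "real (s_count (Suc p) (Q_pieces \<union> {X})) = real (double_fact (2 * p + 2)) + d"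
proof -
  let ?I = "last_nodes p \<union> spine_nodes 0 p"
  let ?A = "\<lambda>f j. f (lower j) < f (lower (Suc j)) \<and> f (lower (Suc j)) < f (upper j) \<and>
    f (lower (Suc j)) < f (upper (Suc j))"
  let ?C = "\<lambda>f j. C (f (lower j)) (f (upper j)) (f (lower (Suc j))) (f (upper (Suc j)))"
  let ?supp = "\<lambda>f. is_support (Q_pieces \<union> {X}) (mat 2 (Suc p + 1) f)"
  have fin: "finite ?I" using finite_last_nodes finite_spine_nodes by blast
  have supp: "?supp f \<longleftrightarrow> spine 0 p f \<and> (?A f p \<or> ?C f p)" if inj: "inj_on f ?I" for f
  proof -
    have "distinct [f (upper j), f (upper (Suc j)), f (lower j), f (lower (Suc j))]"
      if "j < Suc p" for j
    proof -
      have "{upper j, upper (Suc j), lower j, lower (Suc j)} \<subseteq> ?I"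
        unfolding grid_eq[symmetric] using that by auto
      from inj_on_subset[OF inj this] show ?thesis by (auto simp: inj_on_def)
    qed
    then have "?supp f \<longleftrightarrow> (\<forall>j<Suc p. ?A f j \<or> ?C f j)"
      unfolding is_support_iff by (intro all_cong) (simp only: Un_iff singleton_iff red reduction_Q_iff)
    also have "\<dots> \<longleftrightarrow> spine 0 p f \<and> (?A f p \<or> ?C f p)"
    proof (intro iffI conjI)
      assume all: "\<forall>j<Suc p. ?A f j \<or> ?C f j"
      then show "?A f p \<or> ?C f p" by blast
      \<comment> \<open>Piece \<open>j\<close> has a successor, whose left column increases upwards
        under either pattern; this contradicts \<open>C\<close> at \<open>j\<close>.\<close>
      have "?A f j" if "j < p" for j
      proof -
        have "f (lower (Suc j)) < f (upper (Suc j))"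
          using all[rule_format, of "Suc j"] that C by fastforce
        then show ?thesis using all[rule_format, of j] that C[of "f (lower j)"] by force
      qed
      then show "spine 0 p f" by (simp add: spine_def)
    next
      assume *: "spine 0 p f \<and> (?A f p \<or> ?C f p)"
      \<comment> \<open>The spine is silent about \<open>upper p\<close>, so this inequality must
        come from the last piece. It is needed for piece \<open>p - 1\<close>, whose right column is
        column \<open>p\<close>.\<close>
      have up: "f (lower p) < f (upper p)" using * C by fastforce
      have "?A f j" if "j < p" for j
      proof (cases "Suc j < p")
        case True
        then have "f (lower (Suc j)) < f (lower (Suc (Suc j)))"
          "f (lower (Suc (Suc j))) < f (upper (Suc j))"
          using * by (auto simp: spine_def)
        then show ?thesis using * that by (auto simp: spine_def)
      next
        case False
        then have "Suc j = p" using that by simp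
        then show ?thesis using * that up by (auto simp: spine_def)
      qed
      then show "\<forall>j<Suc p. ?A f j \<or> ?C f j" using * less_Suc_eq by metis
    qed
    finally show ?thesis .
  qed
  have "has_count ?I ?supp (real (double_fact (2 * p + 2)) + d)"
  proof (rule has_count_split[OF fin])
    show "has_count ?I (\<lambda>f. ?supp f \<and> ?A f p) (real (double_fact (2 * p + 2)))"
      by (rule has_count_cong[OF has_count_Q]) (use supp in blast)
    have "\<not> ?A f p" if "?C f p" for f
      using C[OF that] by linarith
    then show "has_count ?I (\<lambda>f. ?supp f \<and> \<not> ?A f p) d"
      by (intro has_count_cong[OF count]) (use supp in blast)
  qed
  moreover have "card {1..2 * Suc p + 2} = card ?I"
    unfolding grid_eq[symmetric] by simp
  ultimately have "real (card {f \<in> bijections ?I {1..2 * Suc p + 2}. ?supp f}) =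
      real (double_fact (2 * p + 2)) + d"
    unfolding has_count_def by blast
  then show ?thesis
    unfolding s_count_def S_puzzles_def card_standard_puzzles_Collect grid_eq .
qed

theorem theorem4p3:
  fixes n :: nat
  assumes "n \<ge> 1"
  shows "real (s_count n (Q_pieces \<union> {B1})) = 3 / 2 * real (double_fact (2 * n))
       \<and> real (s_count n (Q_pieces \<union> {B2})) = 3 / 2 * real (double_fact (2 * n))
       \<and> real (s_count n (Q_pieces \<union> {B3})) = 3 / 2 * real (double_fact (2 * n))
       \<and> real (s_count n (Q_pieces \<union> {B4})) =
           (2 * real n + 2) * real (double_fact (2 * n - 1)) - 1 / 2 * real (double_fact (2 * n))
       \<and> real (s_count n (Q_pieces \<union> {B5})) =
           (2 * real n + 2) * real (double_fact (2 * n - 1)) - 1 / 2 * real (double_fact (2 * n))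
       \<and> real (s_count n (Q_pieces \<union> {B6})) =
           (2 * real n ^ 2 + 8 * real n + 1) * real (double_fact (2 * n - 2))
           - (4 * real n + 4) * real (double_fact (2 * n - 1))"
proof -
  \<comment> \<open>Column \<open>p\<close> is now the left column of the last piece.\<close>
  obtain p where n: "n = Suc p" using assms by (cases n) auto
  let ?u = "upper p" and ?u' = "upper (Suc p)" and ?l' = "lower (Suc p)"
  have idx: "2 * n = 2 * p + 2" "2 * n - 1 = 2 * p + 1" "2 * n - 2 = 2 * p" by (simp_all add: n)
  \<comment> \<open>The first three list the chains for \<open>B1\<close>, \<open>B2\<close>,
    \<open>B3\<close> in increasing order. In the last two, for \<open>B4\<close> and
    \<open>B5\<close>, the increasing pair comes first and the node below \<open>lower p\<close>
    last.\<close>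
  have perms: "{?u', ?l', ?u} = last_nodes p" "{?u', ?u, ?l'} = last_nodes p"
    "{?u, ?u', ?l'} = last_nodes p" "{?u, ?l', ?u'} = last_nodes p" "{?l', ?u, ?u'} = last_nodes p"
    by (auto simp: last_nodes_def)
  have "real (s_count n (Q_pieces \<union> {B1})) =
      real (double_fact (2 * p + 2)) + real (double_fact (2 * p + 2)) / 2"
    unfolding n
    by (rule s_count_add_piece[where C = "\<lambda>l u l' u'. l < u' \<and> u' < l' \<and> l' < u",
        OF reduction_piece_iffs(3) _ has_count_last_chain[OF perms(1)]]) auto
  moreover have "real (s_count n (Q_pieces \<union> {B2})) =
      real (double_fact (2 * p + 2)) + real (double_fact (2 * p + 2)) / 2"
    unfolding n
    by (rule s_count_add_piece[where C = "\<lambda>l u l' u'. l < u' \<and> u' < u \<and> u < l'",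
        OF reduction_piece_iffs(4) _ has_count_last_chain[OF perms(2)]]) auto
  moreover have "real (s_count n (Q_pieces \<union> {B3})) =
      real (double_fact (2 * p + 2)) + real (double_fact (2 * p + 2)) / 2"
    unfolding n
    by (rule s_count_add_piece[where C = "\<lambda>l u l' u'. l < u \<and> u < u' \<and> u' < l'",
        OF reduction_piece_iffs(5) _ has_count_last_chain[OF perms(3)]]) auto
  moreover have "real (s_count n (Q_pieces \<union> {B4})) = real (double_fact (2 * p + 2)) +
      ((2 * real p + 4) * real (double_fact (2 * p + 1)) - 3 / 2 * real (double_fact (2 * p + 2)))"
    unfolding n
    by (rule s_count_add_piece[where C = "\<lambda>l u l' u'. u' < l \<and> l < u \<and> u < l'",
        OF reduction_piece_iffs(6) _ has_count_below[OF perms(4)]]) auto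
  moreover have "real (s_count n (Q_pieces \<union> {B5})) = real (double_fact (2 * p + 2)) +
      ((2 * real p + 4) * real (double_fact (2 * p + 1)) - 3 / 2 * real (double_fact (2 * p + 2)))"
    unfolding n
    by (rule s_count_add_piece[where C = "\<lambda>l u l' u'. u' < l \<and> l < l' \<and> l' < u",
        OF reduction_piece_iffs(7) _ has_count_below[OF perms(5)]]) auto
  moreover have "real (s_count n (Q_pieces \<union> {B6})) = real (double_fact (2 * p + 2)) +
      ((2 * real p + 3) * (real p + 2) * real (double_fact (2 * p)) -
       ((4 * real p + 8) * real (double_fact (2 * p + 1)) - 3 / 2 * real (double_fact (2 * p + 2))))"
    unfolding n
    by (rule s_count_add_piece[where C = "\<lambda>l u l' u'. u' < l' \<and> l' < l \<and> l < u",
        OF reduction_piece_iffs(8) _ has_count_B6]) auto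
  \<comment> \<open>For \<open>B6\<close> the multiples of \<open>double_fact (2 * p + 2)\<close>
    have to be merged with those of \<open>double_fact (2 * p)\<close>.\<close>
  moreover have "real (double_fact (2 * p + 2)) = (2 * real p + 2) * real (double_fact (2 * p))"
    by (simp add: algebra_simps)
  ultimately show ?thesis
    unfolding idx n
    by (simp add: field_simps power2_eq_square del: double_fact.simps)
qed

end
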